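(* For all real numbers $a,b$ with $b>a>0$, $$\frac{\pi}{2}\cdot\frac{\ln\bigl(\sqrt{b/a}+\sqrt{b/a-1}\bigr)}{\sqrt{b(b-a)}}\le F(a,b)\le\frac{\pi}{2}\cdot\frac{\arctan\sqrt{b/a-1}}{\sqrt{a(b-a)}},$$ where $F(a,b)=\int_0^{\pi/2}\frac{d\theta}{\sqrt{a^2\cos^2\theta+b^2\sin^2\theta}}$.
   Context: For positive real numbers $a$ and $b$, $F(a,b)=\int_0^{\pi/2}\frac{d\theta}{\sqrt{a^2\cos^2\theta+b^2\sin^2\theta}}$ is a complete elliptic integral (two-parameter form). $\ln$ denotes the natural logarithm. *)

theory Defs
  imports "HOL-Analysis.Analysis"
begin

definition ellF :: "real \<Rightarrow> real \<Rightarrow> real" where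
  "ellF a b =
     integral {0..pi/2} (\<lambda>\<theta>. 1 / sqrt (a\<^sup>2 * (cos \<theta>)\<^sup>2 + b\<^sup>2 * (sin \<theta>)\<^sup>2))"

end

theory Submission
  imports Defs
begin

text \<open>
  Write \<open>c\<close>, \<open>s\<close> for \<open>cos \<theta>\<close>, \<open>sin \<theta>\<close>. Since \<open>a\<^sup>2 c\<^sup>2 + b\<^sup>2 s\<^sup>2 \<ge> (a c\<^sup>2 + b s\<^sup>2)\<^sup>2\<close>, the integral is at most
  \<open>pi / (2 * sqrt (a * b))\<close>, and the upper bound is then \<open>sin x \<le> x\<close> at \<open>x = arctan (sqrt (b / a - 1))\<close>.
  For the lower bound scale to \<open>b = 1\<close> and put \<open>a = 1 - \<kappa>\<^sup>2\<close>: it becomes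
  \<open>pi / 2 * artanh \<kappa> \<le> \<kappa> * ellF (1 - \<kappa>\<^sup>2) 1\<close>, with equality at \<open>\<kappa> = 0\<close>, so it suffices to compare derivatives.
  There the claim reduces to \<open>pi / 4 * (1 + a) \<le> E\<close> for the complete integral \<open>E\<close> of the second kind,
  which follows from the same pointwise inequality.
\<close>

section \<open>Pointwise comparison and an elementary integral\<close>

text \<open>Convexity of the square with weights \<open>(cos \<theta>)\<^sup>2\<close> and
  \<open>(sin \<theta>)\<^sup>2\<close>, which sum to 1; the gap between the squares of the two
  sides is exactly \<open>c * s * (a - b)\<^sup>2\<close>.\<close>

lemma sqrt_weighted_squares_ge:
  fixes a b \<theta> :: real
  assumes "0 \<le> a" "0 \<le> b"
  shows "a * (cos \<theta>)\<^sup>2 + b * (sin \<theta>)\<^sup>2 \<le> sqrt (a\<^sup>2 * (cos \<theta>)\<^sup>2 + b\<^sup>2 * (sin \<theta>)\<^sup>2)"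
proof (rule real_le_rsqrt)
  define c s where "c = (cos \<theta>)\<^sup>2" and "s = (sin \<theta>)\<^sup>2"
  have "c + s = 1" "0 \<le> c" "0 \<le> s" by (auto simp: c_def s_def)
  then have "c = 1 - s" by simp
  have "a\<^sup>2 * c + b\<^sup>2 * s - (a * c + b * s)\<^sup>2 = c * s * (a - b)\<^sup>2"
    unfolding \<open>c = 1 - s\<close> by (simp add: power2_eq_square algebra_simps)
  moreover have "0 \<le> c * s * (a - b)\<^sup>2"
    using \<open>0 \<le> c\<close> \<open>0 \<le> s\<close> by simp
  ultimately show "(a * (cos \<theta>)\<^sup>2 + b * (sin \<theta>)\<^sup>2)\<^sup>2 \<le> a\<^sup>2 * (cos \<theta>)\<^sup>2 + b\<^sup>2 * (sin \<theta>)\<^sup>2"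
    unfolding c_def s_def by linarith
qed

lemma weighted_cos_sin_pos:
  fixes a b \<theta> :: real
  assumes "0 < a" "0 < b"
  shows "0 < a * (cos \<theta>)\<^sup>2 + b * (sin \<theta>)\<^sup>2"
proof (cases "cos \<theta> = 0")
  case True
  then have "(sin \<theta>)\<^sup>2 = 1" using sin_cos_squared_add[of \<theta>] by simp
  then show ?thesis using True assms by simp
next
  case False
  then show ?thesis using assms by (intro add_pos_nonneg) auto
qed

lemma ellF_has_integral:
  assumes "0 < a" "0 < b"
  shows "((\<lambda>\<theta>. 1 / sqrt (a\<^sup>2 * (cos \<theta>)\<^sup>2 + b\<^sup>2 * (sin \<theta>)\<^sup>2)) has_integral ellF a b) {0..pi/2}"
  unfolding ellF_def
proof (intro integrable_integral integrable_continuous_real continuous_intros ballI)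
  fix \<theta> :: real
  show "sqrt (a\<^sup>2 * (cos \<theta>)\<^sup>2 + b\<^sup>2 * (sin \<theta>)\<^sup>2) \<noteq> 0"
    using weighted_cos_sin_pos[of "a\<^sup>2" "b\<^sup>2" \<theta>] assms by simp
qed

text \<open>The antiderivative is \<open>arctan (r * tan \<theta>) / r\<close>, rewritten so that it has no singularity at \<open>pi / 2\<close>.\<close>
lemma has_integral_inverse_weighted_cos_sin:
  fixes r :: real
  assumes "0 < r"
  shows "((\<lambda>\<theta>. 1 / ((cos \<theta>)\<^sup>2 + r\<^sup>2 * (sin \<theta>)\<^sup>2)) has_integral (pi / (2 * r))) {0..pi/2}"
proof -
  \<comment> \<open>By the subtraction formula for the tangent, the inner \<open>arctan\<close> is
    the difference of \<open>arctan (r * tan \<theta>)\<close> and \<theta> before the pole. Its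
    denominator is positive everywhere, so \<open>A\<close> is differentiable on the whole
    line.\<close>
  define A where "A \<theta> = (\<theta> + arctan ((r - 1) * (sin \<theta> * cos \<theta>) / ((cos \<theta>)\<^sup>2 + r * (sin \<theta>)\<^sup>2))) / r"
    for \<theta> :: real
  have "(A has_real_derivative 1 / ((cos \<theta>)\<^sup>2 + r\<^sup>2 * (sin \<theta>)\<^sup>2)) (at \<theta>)" for \<theta>
  proof -
    define c s where "c = cos \<theta>" and "s = sin \<theta>"
    have cs: "c\<^sup>2 + s\<^sup>2 = 1" by (simp add: c_def s_def)
    have pos: "0 < c\<^sup>2 + r * s\<^sup>2" "0 < c\<^sup>2 + r\<^sup>2 * s\<^sup>2"
      using weighted_cos_sin_pos[of 1 r \<theta>] weighted_cos_sin_pos[of 1 "r\<^sup>2" \<theta>] assms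
      by (simp_all add: c_def s_def)
    let ?n = "(r - 1) * (s * c)" and ?d = "c\<^sup>2 + r * s\<^sup>2"
    let ?X = "((r - 1) * (c * c - s * s) * ?d - ?n * (2 * (r - 1) * (s * c))) / ?d\<^sup>2"
    have D: "(A has_real_derivative (1 + inverse (1 + (?n / ?d)\<^sup>2) * ?X) / r) (at \<theta>)"
      unfolding A_def using pos
      by (auto intro!: derivative_eq_intros simp: c_def[symmetric] s_def[symmetric] assms[THEN less_imp_neq, symmetric])
         (simp add: power2_eq_square algebra_simps)
    \<comment> \<open>Brahmagupta's identity: \<open>?d\<close> and \<open>?n\<close> are the real
      and imaginary parts of the product of c - i s and c + i r s.\<close>
    have sq: "?d\<^sup>2 + ?n\<^sup>2 = c\<^sup>2 + r\<^sup>2 * s\<^sup>2"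
    proof -
      have "?d\<^sup>2 + ?n\<^sup>2 = (c\<^sup>2 + s\<^sup>2) * (c\<^sup>2 + r\<^sup>2 * s\<^sup>2)"
        by (simp add: power2_eq_square algebra_simps)
      then show ?thesis by (simp add: cs)
    qed
    have "inverse (1 + (?n / ?d)\<^sup>2) = ?d\<^sup>2 / (?d\<^sup>2 + ?n\<^sup>2)"
      using pos(1) by (simp add: field_simps)
    also have "\<dots> = ?d\<^sup>2 / (c\<^sup>2 + r\<^sup>2 * s\<^sup>2)" by (simp only: sq)
    finally have inv: "inverse (1 + (?n / ?d)\<^sup>2) = ?d\<^sup>2 / (c\<^sup>2 + r\<^sup>2 * s\<^sup>2)" .
    have "(r - 1) * (c * c - s * s) * ?d - ?n * (2 * (r - 1) * (s * c))
       = (r - 1) * (c\<^sup>2 - r * s\<^sup>2) * (c\<^sup>2 + s\<^sup>2)"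
      by (simp add: power2_eq_square algebra_simps)
    then have eq: "inverse (1 + (?n / ?d)\<^sup>2) * ?X = (r - 1) * (c\<^sup>2 - r * s\<^sup>2) / (c\<^sup>2 + r\<^sup>2 * s\<^sup>2)"
      unfolding inv using pos by (simp add: cs)
    have num: "c\<^sup>2 + r\<^sup>2 * s\<^sup>2 + (r - 1) * (c\<^sup>2 - r * s\<^sup>2) = r * (c\<^sup>2 + s\<^sup>2)"
      by (simp add: power2_eq_square algebra_simps)
    have "1 + inverse (1 + (?n / ?d)\<^sup>2) * ?X
       = (c\<^sup>2 + r\<^sup>2 * s\<^sup>2 + (r - 1) * (c\<^sup>2 - r * s\<^sup>2)) / (c\<^sup>2 + r\<^sup>2 * s\<^sup>2)"
      unfolding eq using pos(2) by (simp add: add_divide_distrib)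
    also have "\<dots> = r / (c\<^sup>2 + r\<^sup>2 * s\<^sup>2)" unfolding num cs by simp
    finally have "(1 + inverse (1 + (?n / ?d)\<^sup>2) * ?X) / r = 1 / (c\<^sup>2 + r\<^sup>2 * s\<^sup>2)"
      using assms by simp
    with D show ?thesis by (simp add: c_def s_def)
  qed
  then have "((\<lambda>\<theta>. 1 / ((cos \<theta>)\<^sup>2 + r\<^sup>2 * (sin \<theta>)\<^sup>2)) has_integral (A (pi/2) - A 0)) {0..pi/2}"
    by (intro fundamental_theorem_of_calculus)
       (auto simp: has_real_derivative_iff_has_vector_derivative[symmetric] intro: has_field_derivative_at_within)
  then show ?thesis by (simp add: A_def)
qed

section \<open>Upper bound\<close>

text \<open>The integrand is majorised by \<open>1 / (a * (cos \<theta>)\<^sup>2 + b * (sin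
  \<theta>)\<^sup>2)\<close>. Factoring out \<open>1 / a\<close> leaves the elementary integral with
  \<open>r\<^sup>2 = b / a\<close>.\<close>

lemma ellF_le_geometric_mean:
  assumes "0 < a" "0 < b"
  shows "ellF a b \<le> pi / (2 * sqrt (a * b))"
proof -
  define r where "r = sqrt (b / a)"
  have r: "0 < r" "r\<^sup>2 = b / a" using assms by (simp_all add: r_def)
  have ar: "a * r = sqrt (a * b)"
    using assms by (simp add: r_def real_sqrt_divide real_sqrt_mult) (metis mult.commute mult.assoc real_div_sqrt less_imp_le times_divide_eq_right)
  have "((\<lambda>\<theta>. (1 / a) * (1 / ((cos \<theta>)\<^sup>2 + r\<^sup>2 * (sin \<theta>)\<^sup>2))) has_integral ((1 / a) * (pi / (2 * r)))) {0..pi/2}"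
    by (intro has_integral_mult_right has_integral_inverse_weighted_cos_sin r)
  moreover have "(1 / a) * (1 / ((cos \<theta>)\<^sup>2 + r\<^sup>2 * (sin \<theta>)\<^sup>2)) = 1 / (a * (cos \<theta>)\<^sup>2 + b * (sin \<theta>)\<^sup>2)" for \<theta>
    using assms by (simp add: r(2) distrib_left)
  moreover have "(1 / a) * (pi / (2 * r)) = pi / (2 * sqrt (a * b))"
    by (simp add: ar[symmetric] mult_ac)
  ultimately have I: "((\<lambda>\<theta>. 1 / (a * (cos \<theta>)\<^sup>2 + b * (sin \<theta>)\<^sup>2)) has_integral (pi / (2 * sqrt (a * b)))) {0..pi/2}"
    by (simp only:)
  show ?thesis
  proof (rule has_integral_le[OF ellF_has_integral[OF assms] I])
    fix \<theta> :: real
    show "1 / sqrt (a\<^sup>2 * (cos \<theta>)\<^sup>2 + b\<^sup>2 * (sin \<theta>)\<^sup>2) \<le> 1 / (a * (cos \<theta>)\<^sup>2 + b * (sin \<theta>)\<^sup>2)"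
      using assms by (intro divide_left_mono sqrt_weighted_squares_ge mult_pos_pos
          weighted_cos_sin_pos real_sqrt_gt_zero) auto
  qed
qed

lemma ellF_upper:
  assumes "0 < a" "a < b"
  shows "ellF a b \<le> pi / 2 * (arctan (sqrt (b / a - 1)) / sqrt (a * (b - a)))"
proof -
  define t where "t = sqrt (b / a - 1)"
  have t: "0 < t" "t\<^sup>2 = b / a - 1" using assms by (simp_all add: t_def)
  have at: "sqrt (a * (b - a)) = a * t"
  proof (rule real_sqrt_unique)
    show "(a * t)\<^sup>2 = a * (b - a)"
      using assms by (simp add: power_mult_distrib t(2)) (simp add: power2_eq_square field_simps)
  qed (use assms t in simp)
  have "sqrt (a * b) = a * sqrt (1 + t\<^sup>2)"
  proof (rule real_sqrt_unique)
    show "(a * sqrt (1 + t\<^sup>2))\<^sup>2 = a * b"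
      using assms t(2) by (simp add: power_mult_distrib power2_eq_square[of a])
  qed (use assms in simp)
  \<comment> \<open>The factor \<open>t\<close> is inserted because
    \<open>t / sqrt (1 + t\<^sup>2)\<close> is \<open>sin (arctan t)\<close>: in this form the bound
    differs from the goal only by having \<open>sin (arctan t)\<close> in place of
    \<open>arctan t\<close>.\<close>
  then have ab: "pi / (2 * sqrt (a * b)) = pi / 2 * ((t / sqrt (1 + t\<^sup>2)) / (a * t))"
    using t by (simp add: field_simps)
  have "t / sqrt (1 + t\<^sup>2) \<le> arctan t"
    using sin_x_le_x[of "arctan t"] t by (simp add: sin_arctan)
  then have "pi / (2 * sqrt (a * b)) \<le> pi / 2 * (arctan t / (a * t))"
    unfolding ab using assms t by (intro mult_left_mono divide_right_mono) auto
  then show ?thesis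
    using ellF_le_geometric_mean[of a b] assms unfolding at t_def[symmetric] by simp
qed

section \<open>Derivative estimate for the lower bound\<close>

text \<open>
  The derivative in \<open>\<kappa>\<close> of the integrand of \<open>\<kappa> * ellF (1 - \<kappa>\<^sup>2) 1\<close> is bounded below by
  an explicit derivative in \<open>\<theta>\<close>: adding a multiple of \<open>d/d\<theta> (sin \<theta> * cos \<theta> / \<Delta>) = (p\<^sup>2 cos\<^sup>4 \<theta> - sin\<^sup>4 \<theta>) / \<Delta>\<^sup>3\<close>
  turns it into \<open>2 * \<Delta> / (p * (1 + p)) + (1 - p) / ((1 + p) * \<Delta>)\<close>.
\<close>
lemma derivative_integrand_ge:
  fixes p \<theta> :: real
  assumes "0 < p" "p \<le> 1"
  defines "\<Delta> \<equiv> sqrt (p\<^sup>2 * (cos \<theta>)\<^sup>2 + (sin \<theta>)\<^sup>2)"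
  shows "2 * (p * (cos \<theta>)\<^sup>2 + (sin \<theta>)\<^sup>2) / (p * (1 + p))
           + (2 / p - 2) * ((p\<^sup>2 * (cos \<theta>)^4 - (sin \<theta>)^4) / \<Delta>^3)
         \<le> ((sin \<theta>)\<^sup>2 + (2 * p - p\<^sup>2) * (cos \<theta>)\<^sup>2) / \<Delta>^3"
proof -
  define c s where "c = (cos \<theta>)\<^sup>2" and "s = (sin \<theta>)\<^sup>2"
  have cs: "c = 1 - s" by (simp add: c_def s_def cos_squared_eq)
  have c4: "(cos \<theta>)^4 = c\<^sup>2" "(sin \<theta>)^4 = s\<^sup>2" by (simp_all add: c_def s_def)
  have \<Delta>2: "\<Delta>\<^sup>2 = p\<^sup>2 * c + s" by (simp add: \<Delta>_def c_def s_def)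
  have \<Delta>: "0 < \<Delta>"
    using weighted_cos_sin_pos[of "p\<^sup>2" 1 \<theta>] assms by (simp add: \<Delta>_def)
  have "p * c + s \<le> \<Delta>"
    using sqrt_weighted_squares_ge[of p 1 \<theta>] assms by (simp add: \<Delta>_def c_def s_def)
  then have "2 * (p * c + s) / (p * (1 + p)) \<le> 2 * \<Delta> / (p * (1 + p))"
    using assms by (intro divide_right_mono) auto
  \<comment> \<open>The added term is nonnegative since \<open>p \<le> 1\<close>; with it the sum
    equals the derivative integrand minus the exact \<theta>-derivative, as the remaining steps
    verify.\<close>
  also have "\<dots> \<le> 2 * \<Delta> / (p * (1 + p)) + (1 - p) / ((1 + p) * \<Delta>)"
    using assms \<Delta> by simp
  also have "\<dots> = (2 * \<Delta>^4 + p * (1 - p) * \<Delta>\<^sup>2) / (p * (1 + p) * \<Delta>^3)"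
    using assms \<Delta> by (simp add: divide_simps) (simp add: eval_nat_numeral algebra_simps)
  \<comment> \<open>The coefficient \<open>2 / p - 2\<close> is the one that makes the bracket on
    the right divisible by \<open>\<Delta>\<^sup>2 = p\<^sup>2 * c + s\<close>, given
    \<open>c + s = 1\<close>; this removes the pure \<open>1 / \<Delta>^3\<close> term.\<close>
  also have "2 * \<Delta>^4 + p * (1 - p) * \<Delta>\<^sup>2
      = p * (1 + p) * (s + (2 * p - p\<^sup>2) * c - (2 / p - 2) * (p\<^sup>2 * c\<^sup>2 - s\<^sup>2))"
  proof -
    have "\<Delta>^4 = (p\<^sup>2 * c + s)\<^sup>2" using \<Delta>2 by (metis power2_eq_square power4_eq_xxxx mult.assoc)
    moreover have "p * (1 + p) * (x - (2 / p - 2) * y) = p * (1 + p) * x - (1 + p) * (2 - 2 * p) * y" for x y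
    proof -
      have "p * (1 + p) * (x - l * y) = p * (1 + p) * x - (1 + p) * (p * l) * y" for l
        by (simp add: algebra_simps)
      moreover have "p * (2 / p - 2) = 2 - 2 * p" using assms by (simp add: field_simps)
      ultimately show ?thesis by simp
    qed
    ultimately have "2 * \<Delta>^4 + p * (1 - p) * \<Delta>\<^sup>2
        - p * (1 + p) * (s + (2 * p - p\<^sup>2) * c - (2 / p - 2) * (p\<^sup>2 * c\<^sup>2 - s\<^sup>2))
      = 2 * (p\<^sup>2 * c + s)\<^sup>2 + p * (1 - p) * (p\<^sup>2 * c + s)
        - (p * (1 + p) * (s + (2 * p - p\<^sup>2) * c) - (1 + p) * (2 - 2 * p) * (p\<^sup>2 * c\<^sup>2 - s\<^sup>2))"
      by (simp only: \<Delta>2)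
    also have "\<dots> = 0" unfolding cs by (simp add: eval_nat_numeral algebra_simps)
    finally show ?thesis by simp
  qed
  also have "p * (1 + p) * (s + (2 * p - p\<^sup>2) * c - (2 / p - 2) * (p\<^sup>2 * c\<^sup>2 - s\<^sup>2)) / (p * (1 + p) * \<Delta>^3)
     = (s + (2 * p - p\<^sup>2) * c) / \<Delta>^3 - (2 / p - 2) * ((p\<^sup>2 * c\<^sup>2 - s\<^sup>2) / \<Delta>^3)"
  proof -
    have "p * (1 + p) \<noteq> 0" using assms by simp
    then have "p * (1 + p) * x / (p * (1 + p) * y) = x / y" for x y by (rule mult_divide_mult_cancel_left)
    then show ?thesis by (simp only: diff_divide_distrib[of _ "_ * _"] times_divide_eq_right)
  qed
  finally show ?thesis unfolding c4 unfolding c_def[symmetric] s_def[symmetric] by simp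
qed

text \<open>The term in \<open>sin \<theta> * cos \<theta> / \<Delta> \<theta>\<close> vanishes at
  both endpoints, so only the trigonometric polynomial contributes. At
  \<open>p = 1 - \<kappa>\<^sup>2\<close> the value is the derivative of
  \<open>pi / 2 * artanh \<kappa>\<close>.\<close>

lemma has_integral_lower_integrand:
  fixes p :: real
  assumes "0 < p"
  defines "\<Delta> \<equiv> \<lambda>\<theta>. sqrt (p\<^sup>2 * (cos \<theta>)\<^sup>2 + (sin \<theta>)\<^sup>2)"
  shows "((\<lambda>\<theta>. 2 * (p * (cos \<theta>)\<^sup>2 + (sin \<theta>)\<^sup>2) / (p * (1 + p))
            + (2 / p - 2) * ((p\<^sup>2 * (cos \<theta>)^4 - (sin \<theta>)^4) / \<Delta> \<theta>^3)) has_integral pi / (2 * p)) {0..pi/2}"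
proof -
  define A where "A \<theta> = ((1 + p) * \<theta> + (p - 1) * (sin \<theta> * cos \<theta>)) / (p * (1 + p))
      + (2 / p - 2) * (sin \<theta> * cos \<theta> / \<Delta> \<theta>)" for \<theta>
  have "(A has_real_derivative 2 * (p * (cos \<theta>)\<^sup>2 + (sin \<theta>)\<^sup>2) / (p * (1 + p))
            + (2 / p - 2) * ((p\<^sup>2 * (cos \<theta>)^4 - (sin \<theta>)^4) / \<Delta> \<theta>^3)) (at \<theta>)" for \<theta>
  proof -
    define c s d where "c = cos \<theta>" and "s = sin \<theta>" and "d = \<Delta> \<theta>"
    have cs: "c\<^sup>2 + s\<^sup>2 = 1" by (simp add: c_def s_def)
    have rad: "0 < p\<^sup>2 * (cos \<theta>)\<^sup>2 + (sin \<theta>)\<^sup>2"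
      using weighted_cos_sin_pos[of "p\<^sup>2" 1 \<theta>] assms by simp
    then have d: "0 < d" "d\<^sup>2 = p\<^sup>2 * c\<^sup>2 + s\<^sup>2"
      by (simp_all add: d_def \<Delta>_def c_def s_def)
    have "(\<Delta> has_real_derivative (1 - p\<^sup>2) * (s * c) / d) (at \<theta>)"
      unfolding \<Delta>_def using rad
      by (auto intro!: derivative_eq_intros)
         (simp add: c_def s_def d_def \<Delta>_def field_simps power2_eq_square)
    then have "((\<lambda>\<theta>. sin \<theta> * cos \<theta> / \<Delta> \<theta>) has_real_derivative
        ((c * c - s * s) * d - s * c * ((1 - p\<^sup>2) * (s * c) / d)) / (d * d)) (at \<theta>)"
      using d(1) by (auto intro!: derivative_eq_intros simp: c_def s_def d_def)
    also have "((c * c - s * s) * d - s * c * ((1 - p\<^sup>2) * (s * c) / d)) / (d * d)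
        = ((c * c - s * s) * d\<^sup>2 - s * c * ((1 - p\<^sup>2) * (s * c))) / d^3"
      using d(1) by (simp add: divide_simps) (simp add: eval_nat_numeral algebra_simps)
    also have "(c * c - s * s) * d\<^sup>2 - s * c * ((1 - p\<^sup>2) * (s * c)) = p\<^sup>2 * c^4 - s^4"
      unfolding d(2) by (simp add: eval_nat_numeral algebra_simps)
    finally have D2: "((\<lambda>\<theta>. sin \<theta> * cos \<theta> / \<Delta> \<theta>) has_real_derivative (p\<^sup>2 * c^4 - s^4) / d^3) (at \<theta>)" .
    have "((\<lambda>\<theta>. (1 + p) * \<theta> + (p - 1) * (sin \<theta> * cos \<theta>)) has_real_derivative
        (1 + p) + (p - 1) * (c * c - s * s)) (at \<theta>)"
      by (auto intro!: derivative_eq_intros simp: c_def s_def)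
    also have "(1 + p) + (p - 1) * (c * c - s * s) = (1 + p) * (c\<^sup>2 + s\<^sup>2) + (p - 1) * (c * c - s * s)"
      by (simp add: cs)
    also have "\<dots> = 2 * (p * c\<^sup>2 + s\<^sup>2)" by (simp add: power2_eq_square algebra_simps)
    finally show ?thesis
      unfolding A_def c_def[symmetric] s_def[symmetric] d_def[symmetric]
      by (intro DERIV_add DERIV_cmult D2 DERIV_cdivide)
  qed
  then have "((\<lambda>\<theta>. 2 * (p * (cos \<theta>)\<^sup>2 + (sin \<theta>)\<^sup>2) / (p * (1 + p))
            + (2 / p - 2) * ((p\<^sup>2 * (cos \<theta>)^4 - (sin \<theta>)^4) / \<Delta> \<theta>^3)) has_integral (A (pi/2) - A 0)) {0..pi/2}"
    by (intro fundamental_theorem_of_calculus)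
       (auto simp: has_real_derivative_iff_has_vector_derivative[symmetric] intro: has_field_derivative_at_within)
  moreover have "A (pi/2) - A 0 = pi / (2 * p)"
    using assms by (simp add: A_def)
  ultimately show ?thesis by simp
qed

text \<open>Differentiation under the integral sign, followed by integrating the pointwise lower
  bound. The open interval is symmetric so that 0, where the later comparison starts, is an interior
  point.\<close>

lemma ellF_normalized_derivative:
  fixes \<kappa> :: real
  assumes "\<kappa> \<in> {-1<..<1}"
  defines "p \<equiv> 1 - \<kappa>\<^sup>2"
  obtains J where "((\<lambda>\<kappa>. \<kappa> * ellF (1 - \<kappa>\<^sup>2) 1) has_real_derivative J) (at \<kappa>)" "pi / (2 * p) \<le> J"
proof -
  define \<Delta> where "\<Delta> x \<theta> = sqrt ((1 - x\<^sup>2)\<^sup>2 * (cos \<theta>)\<^sup>2 + (sin \<theta>)\<^sup>2)" for x \<theta> :: real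
  \<comment> \<open>This is the derivative of \<open>x / \<Delta> x \<theta>\<close> in
    \<open>x\<close>. With \<open>p = 1 - x\<^sup>2\<close>, the quotient rule adds
    \<open>2 * x\<^sup>2 * p = 2 * p - 2 * p\<^sup>2\<close> to the coefficient
    \<open>p\<^sup>2\<close> of \<open>(cos \<theta>)\<^sup>2\<close> in
    \<open>(\<Delta> x \<theta>)\<^sup>2\<close>.\<close>
  define g where "g x \<theta> = ((sin \<theta>)\<^sup>2 + (2 * (1 - x\<^sup>2) - (1 - x\<^sup>2)\<^sup>2) * (cos \<theta>)\<^sup>2) / \<Delta> x \<theta>^3" for x \<theta>
  have p: "0 < 1 - x\<^sup>2" if "x \<in> {-1<..<1}" for x :: real
    using that by (simp add: abs_square_less_1 abs_less_iff)
  have rad: "0 < (1 - x\<^sup>2)\<^sup>2 * (cos \<theta>)\<^sup>2 + (sin \<theta>)\<^sup>2" if "x \<in> {-1<..<1}" for x \<theta> :: real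
    using weighted_cos_sin_pos[of "(1 - x\<^sup>2)\<^sup>2" 1 \<theta>] p[OF that] by simp
  have \<Delta>: "0 < \<Delta> x \<theta>" "(\<Delta> x \<theta>)\<^sup>2 = (1 - x\<^sup>2)\<^sup>2 * (cos \<theta>)\<^sup>2 + (sin \<theta>)\<^sup>2" if "x \<in> {-1<..<1}" for x \<theta>
    using rad[OF that, of \<theta>] by (simp_all add: \<Delta>_def)
  have D: "((\<lambda>x. x / \<Delta> x \<theta>) has_real_derivative g x \<theta>) (at x)" if x: "x \<in> {-1<..<1}" for x \<theta>
  proof -
    have "((\<lambda>x. \<Delta> x \<theta>) has_real_derivative - (2 * x * (1 - x\<^sup>2) * (cos \<theta>)\<^sup>2) / \<Delta> x \<theta>) (at x)"
      unfolding \<Delta>_def using rad[OF x, of \<theta>]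
      by (auto intro!: derivative_eq_intros) (simp add: field_simps power2_eq_square)
    then have "((\<lambda>x. x / \<Delta> x \<theta>) has_real_derivative
        (1 * \<Delta> x \<theta> - x * (- (2 * x * (1 - x\<^sup>2) * (cos \<theta>)\<^sup>2) / \<Delta> x \<theta>)) / (\<Delta> x \<theta> * \<Delta> x \<theta>)) (at x)"
      using \<Delta>[OF x, of \<theta>] by (intro DERIV_divide DERIV_ident) auto
    also have "(1 * \<Delta> x \<theta> - x * (- (2 * x * (1 - x\<^sup>2) * (cos \<theta>)\<^sup>2) / \<Delta> x \<theta>)) / (\<Delta> x \<theta> * \<Delta> x \<theta>)
        = ((\<Delta> x \<theta>)\<^sup>2 + 2 * x\<^sup>2 * (1 - x\<^sup>2) * (cos \<theta>)\<^sup>2) / \<Delta> x \<theta>^3"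
      using \<Delta>(1)[OF x, of \<theta>] by (simp add: divide_simps) (simp add: eval_nat_numeral algebra_simps)
    also have "\<dots> = g x \<theta>"
      unfolding g_def \<Delta>(2)[OF x] by (simp add: eval_nat_numeral algebra_simps)
    finally show ?thesis .
  qed
  have cont: "continuous_on ({-1<..<1} \<times> cbox 0 (pi/2)) (\<lambda>(x, \<theta>). g x \<theta>)"
    unfolding g_def case_prod_unfold
  proof (intro continuous_intros ballI)
    show "continuous_on ({-1<..<1} \<times> cbox 0 (pi/2)) (\<lambda>z. \<Delta> (fst z) (snd z))"
      unfolding \<Delta>_def by (intro continuous_intros)
    show "\<Delta> (fst z) (snd z) ^ 3 \<noteq> 0" if "z \<in> {-1<..<1} \<times> cbox 0 (pi/2)" for z
      using \<Delta>(1)[of "fst z" "snd z"] that by (cases z) auto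
  qed
  have int: "((\<lambda>\<theta>. x / \<Delta> x \<theta>) has_integral x * ellF (1 - x\<^sup>2) 1) (cbox 0 (pi/2))" if "x \<in> {-1<..<1}" for x
    using has_integral_mult_right[OF ellF_has_integral[OF p[OF that] zero_less_one], of x]
    by (simp add: \<Delta>_def)
  have "((\<lambda>x. integral (cbox 0 (pi/2)) (\<lambda>\<theta>. x / \<Delta> x \<theta>)) has_real_derivative
      integral (cbox 0 (pi/2)) (g \<kappa>)) (at \<kappa> within {-1<..<1})"
    using int assms
    by (intro leibniz_rule_field_derivative[where U = "{-1<..<1}"] cont)
       (auto intro: has_field_derivative_at_within[OF D] has_integral_integrable)
  then have "((\<lambda>x. integral (cbox 0 (pi/2)) (\<lambda>\<theta>. x / \<Delta> x \<theta>)) has_real_derivative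
      integral (cbox 0 (pi/2)) (g \<kappa>)) (at \<kappa>)"
    using assms by (simp add: at_within_open[of \<kappa> "{-1<..<1}"])
  \<comment> \<open>The parameter integral has been identified with
    \<open>x * ellF (1 - x\<^sup>2) 1\<close> only on the open interval, which suffices for the
    derivative at an interior point.\<close>
  then have "((\<lambda>\<kappa>. \<kappa> * ellF (1 - \<kappa>\<^sup>2) 1) has_real_derivative integral (cbox 0 (pi/2)) (g \<kappa>)) (at \<kappa>)"
    by (rule has_field_derivative_transform_within_open[where S = "{-1<..<1}"])
       (use int assms in \<open>auto dest: integral_unique\<close>)
  moreover have "pi / (2 * p) \<le> integral (cbox 0 (pi/2)) (g \<kappa>)"
  proof -
    have "continuous_on (cbox 0 (pi/2)) (g \<kappa>)"
    proof -
      have "continuous_on (cbox 0 (pi/2)) ((\<lambda>(x, \<theta>). g x \<theta>) \<circ> (\<lambda>\<theta>. (\<kappa>, \<theta>)))"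
        using assms by (intro continuous_on_compose continuous_intros continuous_on_subset[OF cont]) auto
      then show ?thesis by (simp add: o_def)
    qed
    then have "(g \<kappa> has_integral integral (cbox 0 (pi/2)) (g \<kappa>)) {0..pi/2}"
      by (simp add: integrable_continuous_real integrable_integral)
    moreover have "0 < p" "p \<le> 1" using p assms by (auto simp: p_def)
    ultimately show ?thesis
      using derivative_integrand_ge[of p]
      by (intro has_integral_le[OF has_integral_lower_integrand[of p]])
         (auto simp: g_def \<Delta>_def p_def)
  qed
  ultimately show ?thesis by (rule that)
qed

section \<open>Lower bound\<close>

lemma artanh_le_ellF:
  fixes \<kappa> :: real
  assumes "0 \<le> \<kappa>" "\<kappa> < 1"
  shows "pi / 2 * artanh \<kappa> \<le> \<kappa> * ellF (1 - \<kappa>\<^sup>2) 1"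
proof -
  define H where "H x = x * ellF (1 - x\<^sup>2) 1 - pi / 2 * artanh x" for x :: real
  have "H 0 \<le> H \<kappa>"
  proof (rule DERIV_nonneg_imp_nondecreasing[OF assms(1)])
    fix x assume "0 \<le> x" "x \<le> \<kappa>"
    with assms have x: "x \<in> {-1<..<1}" by auto
    then obtain J where J: "((\<lambda>x. x * ellF (1 - x\<^sup>2) 1) has_real_derivative J) (at x)"
        "pi / (2 * (1 - x\<^sup>2)) \<le> J"
      by (rule ellF_normalized_derivative)
    have "(H has_real_derivative J - pi / 2 * (1 / (1 - x\<^sup>2))) (at x)"
      unfolding H_def using x by (intro DERIV_diff DERIV_cmult J artanh_real_has_field_derivative) auto
    moreover have "0 \<le> J - pi / 2 * (1 / (1 - x\<^sup>2))" using J(2) by simp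
    ultimately show "\<exists>y. (H has_real_derivative y) (at x) \<and> 0 \<le> y" by blast
  qed
  then show ?thesis by (simp add: H_def)
qed

lemma ellF_scale:
  assumes "0 < b"
  shows "ellF a b = ellF (a / b) 1 / b"
proof -
  have "sqrt (a\<^sup>2 * (cos \<theta>)\<^sup>2 + b\<^sup>2 * (sin \<theta>)\<^sup>2) = b * sqrt ((a / b)\<^sup>2 * (cos \<theta>)\<^sup>2 + (sin \<theta>)\<^sup>2)" for \<theta>
  proof -
    have "a\<^sup>2 * (cos \<theta>)\<^sup>2 + b\<^sup>2 * (sin \<theta>)\<^sup>2 = b\<^sup>2 * ((a / b)\<^sup>2 * (cos \<theta>)\<^sup>2 + (sin \<theta>)\<^sup>2)"
      using assms by (simp add: field_simps)
    then show ?thesis using assms by (simp add: real_sqrt_mult)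
  qed
  then have "ellF a b = integral {0..pi/2} (\<lambda>\<theta>. (1 / b) * (1 / sqrt ((a / b)\<^sup>2 * (cos \<theta>)\<^sup>2 + 1\<^sup>2 * (sin \<theta>)\<^sup>2)))"
    by (simp add: ellF_def)
  then show ?thesis
    unfolding ellF_def[of "a / b"] by (simp only: integral_mult_right) simp
qed

text \<open>With \<open>\<kappa>\<^sup>2 = 1 - a / b\<close> the logarithm is
  \<open>artanh \<kappa>\<close> and the root in the denominator is \<open>\<kappa> * b\<close>. The
  claim is then the \<open>artanh\<close> estimate divided by \<open>\<kappa> * b\<close>, since
  \<open>ellF\<close> is homogeneous of degree -1.\<close>

lemma ellF_lower:
  assumes "0 < a" "a < b"
  shows "pi / 2 * (ln (sqrt (b / a) + sqrt (b / a - 1)) / sqrt (b * (b - a))) \<le> ellF a b"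
proof -
  define \<kappa> q where "\<kappa> = sqrt (1 - a / b)" and "q = sqrt (b / a)"
  have \<kappa>: "0 < \<kappa>" "\<kappa> < 1" "\<kappa>\<^sup>2 = 1 - a / b" using assms by (simp_all add: \<kappa>_def)
  have q: "0 < q" "q\<^sup>2 = b / a" using assms by (simp_all add: q_def)
  have 1: "sqrt (b / a - 1) = \<kappa> * q"
  proof (rule real_sqrt_unique)
    show "(\<kappa> * q)\<^sup>2 = b / a - 1" using assms by (simp add: power_mult_distrib \<kappa> q field_simps)
  qed (use \<kappa> q in simp)
  have 2: "sqrt (b * (b - a)) = \<kappa> * b"
  proof (rule real_sqrt_unique)
    show "(\<kappa> * b)\<^sup>2 = b * (b - a)" using assms by (simp add: power_mult_distrib \<kappa>) (simp add: field_simps power2_eq_square)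
  qed (use \<kappa> assms in simp)
  \<comment> \<open>Squaring reaches the quotient inside \<open>artanh\<close>, which is half the
    logarithm of \<open>(1 + \<kappa>) / (1 - \<kappa>)\<close>; the key relation is
    \<open>(1 - \<kappa>\<^sup>2) * q\<^sup>2 = 1\<close>.\<close>
  have "(q + \<kappa> * q)\<^sup>2 = (1 + \<kappa>) / (1 - \<kappa>)"
  proof -
    have "(1 - \<kappa>) * (q + \<kappa> * q)\<^sup>2 = (1 + \<kappa>) * ((1 - \<kappa>\<^sup>2) * q\<^sup>2)"
      by (simp add: power2_eq_square algebra_simps)
    also have "(1 - \<kappa>\<^sup>2) * q\<^sup>2 = 1" using assms by (simp add: \<kappa> q)
    finally show ?thesis using \<kappa> by (simp add: field_simps)
  qed
  then have "artanh \<kappa> = ln ((q + \<kappa> * q)\<^sup>2) / 2" by (simp add: artanh_def)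
  also have "\<dots> = ln (q + \<kappa> * q)"
    using \<kappa> q by (simp add: ln_realpow add_pos_pos)
  finally have 3: "ln (q + \<kappa> * q) = artanh \<kappa>" by simp
  have "pi / 2 * (artanh \<kappa> / (\<kappa> * b)) = (pi / 2 * artanh \<kappa>) / (\<kappa> * b)" by simp
  also have "\<dots> \<le> (\<kappa> * ellF (1 - \<kappa>\<^sup>2) 1) / (\<kappa> * b)"
    using \<kappa> assms by (intro divide_right_mono artanh_le_ellF) auto
  also have "\<dots> = ellF a b" using \<kappa> assms by (simp add: ellF_scale[of b a])
  finally show ?thesis unfolding 1 2 q_def[symmetric] 3 .
qed

theorem theorem2:
  fixes a b :: real
  assumes "0 < a" and "a < b"
  shows "pi / 2 * (ln (sqrt (b / a) + sqrt (b / a - 1)) / sqrt (b * (b - a))) \<le> ellF a b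
       \<and> ellF a b \<le> pi / 2 * (arctan (sqrt (b / a - 1)) / sqrt (a * (b - a)))"
  using ellF_lower[OF assms] ellF_upper[OF assms] by blast

end
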